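(* Assume the setting described in the context. Let $\mathbf{x}=\mathbf{A}^{-1}\mathbf{b}$, and assume that the error propagation matrix $\mathbf{E}$ of the exV-cycle method satisfies $\|\mathbf{E}\|_{\mathbf{A}}<1$. Let $n_{\mathrm{it}}\ge1$, and let $\mathbf{x}^{(n_{\mathrm{it}})}_{\mathrm{ex}}$ and $\mathbf{x}^{(n_{\mathrm{it}})}_{\mathrm{in}}$ be the approximations computed after $n_{\mathrm{it}}$ iterations of the exV-cycle method and of the inV-cycle method, respectively, starting from the same initial approximation $\mathbf{x}^{(0)}$. Suppose that for $k=1,\dots,n_{\mathrm{it}}$ the quantity $\eta(\mathbf{v}^{(k)}_{0,\mathrm{in}})$ is an upper bound on the coarsest-level error in the $k$th inV-cycle iteration, $$\|\mathbf{v}_0^{(k)}-\mathbf{v}_{0,\mathrm{in}}^{(k)}\|_{\mathbf{A}_0}\le\eta(\mathbf{v}^{(k)}_{0,\mathrm{in}}),$$ and that the coarsest-level stopping criterion $$\eta(\mathbf{v}^{(k)}_{0,\mathrm{in}})\le\epsilon,\qquad k=1,\dots,n_{\mathrm{it}},$$ holds for some $\epsilon>0$. Then $$\|\mathbf{x}^{(n_{\mathrm{it}})}_{\mathrm{ex}}-\mathbf{x}^{(n_{\mathrm{it}})}_{\mathrm{in}}\|_{\mathbf{A}}\le\frac{\epsilon}{1-\|\mathbf{E}\|_{\mathbf{A}}}.$$ If moreover $\|\mathbf{E}\|_{\mathbf{A}}<\alpha$ for some $\alpha<1$, then $$\|\mathbf{x}^{(n_{\mathrm{it}})}_{\mathrm{ex}}-\mathbf{x}^{(n_{\mathrm{it}})}_{\mathrm{in}}\|_{\mathbf{A}}\le\frac{\epsilon}{1-\alpha};$$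 in particular, if $\epsilon=(1-\alpha)\theta$ with $\theta>0$, then $$\|\mathbf{x}-\mathbf{x}^{(n_{\mathrm{it}})}_{\mathrm{in}}\|_{\mathbf{A}}\le\|\mathbf{x}-\mathbf{x}^{(n_{\mathrm{it}})}_{\mathrm{ex}}\|_{\mathbf{A}}+\theta.$$
   Context: Setting. $\mathbf{A}\in\mathbb{R}^{n\times n}$ is symmetric positive definite (SPD) and $\mathbf{b}\in\mathbb{R}^n$. There are $J+1$ levels $0,\dots,J$ ($J\ge1$; level $0$ is the coarsest, level $J$ the finest), with system matrices $\mathbf{A}_j\in\mathbb{R}^{n_j\times n_j}$, $n_J=n$, $\mathbf{A}_J=\mathbf{A}$, and prolongation matrices $\mathbf{P}_j\in\mathbb{R}^{n_j\times n_{j-1}}$, $j=1,\dots,J$, of full (column) rank, satisfying the Galerkin condition $\mathbf{A}_{j-1}=\mathbf{P}_j^\top\mathbf{A}_j\mathbf{P}_j$ for $j=1,\dots,J$ (so all $\mathbf{A}_j$ are SPD). $\mathbf{I}_j\in\mathbb{R}^{n_j\times n_j}$ is the identity. Norms. $\|\cdot\|$ is the Euclidean norm, $\|\mathbf{v}\|_{\mathbf{A}_j}=\|\mathbf{A}_j^{1/2}\mathbf{v}\|$; the same symbols denote the induced matrix norms. Smoothers. $\mathbf{M}_j,\mathbf{N}_j\in\mathbb{R}^{n_j\times n_j}$, $j=1,\dots,J$, are non-singular matrices (not necessarily symmetric) with $\|\mathbf{I}_j-\mathbf{M}_j\mathbf{A}_j\|_{\mathbf{A}_j}<1$ and $\|\mathbf{I}_j-\mathbf{N}_j\mathbf{A}_j\|_{\mathbf{A}_j}<1$.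 Also allowed: no pre-smoothing (all $\mathbf{M}_j=\mathbf{0}$, with the $\mathbf{N}_j$ non-singular and satisfying $\|\mathbf{I}_j-\mathbf{N}_j\mathbf{A}_j\|_{\mathbf{A}_j}<1$) or no post-smoothing (all $\mathbf{N}_j=\mathbf{0}$, with the $\mathbf{M}_j$ non-singular and satisfying $\|\mathbf{I}_j-\mathbf{M}_j\mathbf{A}_j\|_{\mathbf{A}_j}<1$). V-cycle. One iteration maps $\mathbf{x}^{\mathrm{prev}}$ to $\mathbf{x}^{\mathrm{new}}=\mathbf{V}(\mathbf{b},\mathbf{x}^{\mathrm{prev}},J)$, where $\mathbf{V}(\mathbf{f}_j,\mathbf{v}_j^{[0]},j)$ is defined recursively. For $j\ne0$: $\mathbf{v}_j^{[1]}=\mathbf{v}_j^{[0]}+\mathbf{M}_j(\mathbf{f}_j-\mathbf{A}_j\mathbf{v}_j^{[0]})$; $\mathbf{f}_{j-1}=\mathbf{P}_j^\top(\mathbf{f}_j-\mathbf{A}_j\mathbf{v}_j^{[1]})$; $\mathbf{v}_{j-1}^{[2]}=\mathbf{V}(\mathbf{f}_{j-1},\mathbf{0},j-1)$; $\mathbf{v}_j^{[3]}=\mathbf{v}_j^{[1]}+\mathbf{P}_j\mathbf{v}_{j-1}^{[2]}$; $\mathbf{v}_j^{[4]}=\mathbf{v}_j^{[3]}+\mathbf{N}_j(\mathbf{f}_j-\mathbf{A}_j\mathbf{v}_j^{[3]})$; return $\mathbf{v}_j^{[4]}$. For $j=0$: return an exact or approximate solution of $\mathbf{A}_0\mathbf{v}_0=\mathbf{f}_0$.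 In the exV-cycle method the exact solution $\mathbf{A}_0^{-1}\mathbf{f}_0$ is returned; in the inV-cycle method an approximation in $\mathbb{R}^{n_0}$, computed by an arbitrary (possibly nonlinear) solver, is returned. All other computations are exact. In the $k$th iteration of the inV-cycle method (computing $\mathbf{x}_{\mathrm{in}}^{(k)}$ from $\mathbf{x}_{\mathrm{in}}^{(k-1)}$, with $\mathbf{x}_{\mathrm{in}}^{(0)}=\mathbf{x}^{(0)}$), $\mathbf{v}_0^{(k)}=\mathbf{A}_0^{-1}\mathbf{f}_0^{(k)}$ is the exact solution of the coarsest-level problem with the right-hand side $\mathbf{f}_0^{(k)}$ arising in that iteration, $\mathbf{v}_{0,\mathrm{in}}^{(k)}$ is the computed approximation that is used, and $\eta(\mathbf{v}_{0,\mathrm{in}}^{(k)})$ is a real number (an error estimate). Error propagation matrix. $\mathbf{E}\in\mathbb{R}^{n\times n}$ is the matrix, independent of $\mathbf{b}$ and $\mathbf{x}^{\mathrm{prev}}$, for which one exV-cycle iteration (result $\mathbf{x}^{\mathrm{new}}_{\mathrm{ex}}$) satisfies $\mathbf{x}-\mathbf{x}^{\mathrm{new}}_{\mathrm{ex}}=\mathbf{E}(\mathbf{x}-\mathbf{x}^{\mathrm{prev}})$ for all $\mathbf{b}$ and $\mathbf{x}^{\mathrm{prev}}$, with $\mathbf{x}=\mathbf{A}^{-1}\mathbf{b}$. *)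

theory Defs
  imports
    "HOL-Analysis.L2_Norm"
    "Jordan_Normal_Form.Gauss_Jordan_Elimination"
    "Jordan_Normal_Form.DL_Rank"
begin

definition eucl_norm :: "real vec \<Rightarrow> real" where
  "eucl_norm v = L2_set (($) v) {..<dim_vec v}"

definition spd_mat :: "real mat \<Rightarrow> bool" where
  "spd_mat A \<longleftrightarrow> square_mat A \<and> transpose_mat A = A \<and>
    (\<forall>v \<in> carrier_vec (dim_row A). v \<noteq> 0\<^sub>v (dim_row A) \<longrightarrow> v \<bullet> (A *\<^sub>v v) > 0)"

(* A symmetric positive definite matrix has exactly one symmetric positive definite
   square root, so the choice below is unambiguous. *)
definition sqrt_mat :: "real mat \<Rightarrow> real mat" where
  "sqrt_mat A = (SOME B. B \<in> carrier_mat (dim_row A) (dim_row A) \<and> spd_mat B \<and> B * B = A)"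

definition energy_norm :: "real mat \<Rightarrow> real vec \<Rightarrow> real" where
  "energy_norm A v = eucl_norm (sqrt_mat A *\<^sub>v v)"

(* As for onorm in HOL-Analysis, the vector v = 0 contributes the value 0/0 = 0. *)
definition energy_mat_norm :: "real mat \<Rightarrow> real mat \<Rightarrow> real" where
  "energy_mat_norm A B =
    (SUP v \<in> carrier_vec (dim_col B). energy_norm A (B *\<^sub>v v) / energy_norm A v)"

definition mat_inv :: "real mat \<Rightarrow> real mat" where
  "mat_inv A = the (mat_inverse A)"

definition convergent_smoother :: "nat \<Rightarrow> real mat \<Rightarrow> real mat \<Rightarrow> bool" where
  "convergent_smoother m A G \<longleftrightarrow>
    G \<in> carrier_mat m m \<and> invertible_mat G \<and> energy_mat_norm A (1\<^sub>m m - G * A) < 1"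

definition smooth :: "real mat \<Rightarrow> real mat \<Rightarrow> real vec \<Rightarrow> real vec \<Rightarrow> real vec" where
  "smooth A G f v = v + G *\<^sub>v (f - A *\<^sub>v v)"

definition restricted_residual ::
  "real mat \<Rightarrow> real mat \<Rightarrow> real mat \<Rightarrow> real vec \<Rightarrow> real vec \<Rightarrow> real vec" where
  "restricted_residual A P M f v = transpose_mat P *\<^sub>v (f - A *\<^sub>v smooth A M f v)"

(* The families n, A, P, M, N are indexed by the level; S is the coarsest-level solver,
   which maps a right-hand side to the returned vector. *)
primrec vcycle ::
  "(nat \<Rightarrow> nat) \<Rightarrow> (nat \<Rightarrow> real mat) \<Rightarrow> (nat \<Rightarrow> real mat) \<Rightarrow> (nat \<Rightarrow> real mat) \<Rightarrow> (nat \<Rightarrow> real mat) \<Rightarrow>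
    (real vec \<Rightarrow> real vec) \<Rightarrow> nat \<Rightarrow> real vec \<Rightarrow> real vec \<Rightarrow> real vec" where
  "vcycle n A P M N S 0 f v = S f"
| "vcycle n A P M N S (Suc j) f v =
    (let v1 = smooth (A (Suc j)) (M (Suc j)) f v;
         f' = restricted_residual (A (Suc j)) (P (Suc j)) (M (Suc j)) f v;
         v2 = vcycle n A P M N S j f' (0\<^sub>v (n j));
         v3 = v1 + P (Suc j) *\<^sub>v v2
     in smooth (A (Suc j)) (N (Suc j)) f v3)"

(* The right-hand side that a V-cycle started on level j passes to its coarsest-level
   solver; it is fixed before that solver is called. *)
primrec coarse_rhs ::
  "(nat \<Rightarrow> nat) \<Rightarrow> (nat \<Rightarrow> real mat) \<Rightarrow> (nat \<Rightarrow> real mat) \<Rightarrow> (nat \<Rightarrow> real mat) \<Rightarrow>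
    nat \<Rightarrow> real vec \<Rightarrow> real vec \<Rightarrow> real vec" where
  "coarse_rhs n A P M 0 f v = f"
| "coarse_rhs n A P M (Suc j) f v =
    coarse_rhs n A P M j (restricted_residual (A (Suc j)) (P (Suc j)) (M (Suc j)) f v) (0\<^sub>v (n j))"

definition exact_solver :: "(nat \<Rightarrow> real mat) \<Rightarrow> real vec \<Rightarrow> real vec" where
  "exact_solver A f = mat_inv (A 0) *\<^sub>v f"

(* The coarsest-level solver S k may differ from one iteration k to the next: it may depend
   on the history of the computation, on random choices, etc. *)
primrec inV_iterate ::
  "(nat \<Rightarrow> nat) \<Rightarrow> (nat \<Rightarrow> real mat) \<Rightarrow> (nat \<Rightarrow> real mat) \<Rightarrow> (nat \<Rightarrow> real mat) \<Rightarrow> (nat \<Rightarrow> real mat) \<Rightarrow>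
    (nat \<Rightarrow> real vec \<Rightarrow> real vec) \<Rightarrow> nat \<Rightarrow> real vec \<Rightarrow> real vec \<Rightarrow> nat \<Rightarrow> real vec" where
  "inV_iterate n A P M N S J b x0 0 = x0"
| "inV_iterate n A P M N S J b x0 (Suc k) =
    vcycle n A P M N (S (Suc k)) J b (inV_iterate n A P M N S J b x0 k)"

primrec exV_iterate ::
  "(nat \<Rightarrow> nat) \<Rightarrow> (nat \<Rightarrow> real mat) \<Rightarrow> (nat \<Rightarrow> real mat) \<Rightarrow> (nat \<Rightarrow> real mat) \<Rightarrow> (nat \<Rightarrow> real mat) \<Rightarrow>
    nat \<Rightarrow> real vec \<Rightarrow> real vec \<Rightarrow> nat \<Rightarrow> real vec" where
  "exV_iterate n A P M N J b x0 0 = x0"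
| "exV_iterate n A P M N J b x0 (Suc k) =
    vcycle n A P M N (exact_solver A) J b (exV_iterate n A P M N J b x0 k)"

definition error_propagation_mat ::
  "(nat \<Rightarrow> nat) \<Rightarrow> (nat \<Rightarrow> real mat) \<Rightarrow> (nat \<Rightarrow> real mat) \<Rightarrow> (nat \<Rightarrow> real mat) \<Rightarrow> (nat \<Rightarrow> real mat) \<Rightarrow>
    nat \<Rightarrow> real mat \<Rightarrow> bool" where
  "error_propagation_mat n A P M N J E \<longleftrightarrow>
    E \<in> carrier_mat (n J) (n J) \<and>
    (\<forall>b \<in> carrier_vec (n J). \<forall>xprev \<in> carrier_vec (n J).
      mat_inv (A J) *\<^sub>v b - vcycle n A P M N (exact_solver A) J b xprev
        = E *\<^sub>v (mat_inv (A J) *\<^sub>v b - xprev))"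

end

theory Submission
  imports Defs "Jordan_Normal_Form.Matrix_Kernel"
begin

text \<open>One V-cycle with an inexact coarsest-level solver differs from the exact one, started from the
  same vector, by the coarsest-level error propagated upwards by prolongations (isometries for the
  energy norms, by the Galerkin condition) and post-smoothing steps (which do not expand the energy
  norm). Hence the distance \<open>e\<^sub>k\<close> of the two iterates satisfies \<open>e\<^sub>k \<le> q e\<^sub>k\<^sub>-\<^sub>1 + eps\<close> with \<open>e\<^sub>0 = 0\<close>, where
  \<open>q\<close> is the energy norm of the error propagation matrix, and so \<open>e\<^sub>k \<le> eps / (1 - q)\<close>.\<close>

text \<open>The energy norm rests on \<open>sqrt_mat\<close>, a choice that says nothing until a
  symmetric positive definite root is known to exist. This is the main obstacle. Existence is
  obtained over the reals, with neither compactness nor complex eigenvalues, by splitting off one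
  eigenvector at a time; each eigenvalue is a supremum of Rayleigh quotients. The induced norm is a
  supremum as well, so its quotients must be bounded before it yields any estimate. In the
  comparison of the iterates the inexact cycle may be nonlinear, so two inexact cycles with
  different starting vectors cannot be compared. Hence the exact cycle applied to the inexact
  iterate is inserted between the two new iterates: one part of the difference is governed by
  \<open>E\<close>, the other by the coarsest-level error alone.\<close>

lemma eucl_norm_nonneg: "eucl_norm v \<ge> 0"
  by (simp add: eucl_norm_def)

lemma eucl_norm_square: "(eucl_norm v)\<^sup>2 = v \<bullet> v"
  by (simp add: eucl_norm_def L2_set_def sum_nonneg scalar_prod_def power2_eq_square atLeast0LessThan)

lemma eucl_norm_triangle:
  assumes "v \<in> carrier_vec n" "w \<in> carrier_vec n"
  shows "eucl_norm (v + w) \<le> eucl_norm v + eucl_norm w"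
proof -
  have "eucl_norm (v + w) = L2_set (\<lambda>i. v $ i + w $ i) {..<n}"
    using assms by (auto simp: eucl_norm_def intro!: L2_set_cong)
  also have "\<dots> \<le> eucl_norm v + eucl_norm w"
    using L2_set_triangle_ineq[of "($) v" "($) w" "{..<n}"] assms by (simp add: eucl_norm_def)
  finally show ?thesis .
qed

lemma scalar_prod_le_eucl_norm:
  assumes "v \<in> carrier_vec n" "w \<in> carrier_vec n"
  shows "\<bar>v \<bullet> w\<bar> \<le> eucl_norm v * eucl_norm w"
proof -
  have "\<bar>v \<bullet> w\<bar> \<le> (\<Sum>i<n. \<bar>v $ i\<bar> * \<bar>w $ i\<bar>)"
    using assms sum_abs[of "\<lambda>i. v $ i * w $ i" "{..<n}"]
    by (simp add: scalar_prod_def abs_mult atLeast0LessThan)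
  also have "\<dots> \<le> eucl_norm v * eucl_norm w"
    using L2_set_mult_ineq[of "($) v" "($) w" "{..<n}"] assms by (simp add: eucl_norm_def)
  finally show ?thesis .
qed

text \<open>Each entry of the product is a scalar product with a row, so the sum of the row norms
  serves as \<open>K\<close>. This value is crude, but the suprema below only call for some finite
  bound.\<close>

lemma eucl_norm_mult_mat_vec_bound:
  fixes M :: "real mat"
  assumes M: "M \<in> carrier_mat m n"
  obtains K where "K \<ge> 0"
    "\<And>v. v \<in> carrier_vec n \<Longrightarrow> eucl_norm (M *\<^sub>v v) \<le> K * eucl_norm v"
proof
  show "(\<Sum>i<m. eucl_norm (row M i)) \<ge> 0"
    by (simp add: sum_nonneg eucl_norm_nonneg)
  fix v :: "real vec" assume v: "v \<in> carrier_vec n"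
  have "eucl_norm (M *\<^sub>v v) \<le> (\<Sum>i<m. \<bar>(M *\<^sub>v v) $ i\<bar>)"
    using L2_set_le_sum_abs[of "($) (M *\<^sub>v v)" "{..<m}"] M by (simp add: eucl_norm_def)
  also have "\<dots> \<le> (\<Sum>i<m. eucl_norm (row M i) * eucl_norm v)"
    using M v by (auto intro!: sum_mono scalar_prod_le_eucl_norm)
  finally show "eucl_norm (M *\<^sub>v v) \<le> (\<Sum>i<m. eucl_norm (row M i)) * eucl_norm v"
    by (simp add: sum_distrib_right)
qed

lemma scalar_prod_self_nonneg: "v \<bullet> v \<ge> (0::real)"
  using eucl_norm_square[of v] by (metis zero_le_power2)

lemma scalar_prod_self_eq_0:
  assumes "(v :: real vec) \<in> carrier_vec n"
  shows "v \<bullet> v = 0 \<longleftrightarrow> v = 0\<^sub>v n"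
proof
  assume "v \<bullet> v = 0"
  then have "\<forall>i<n. v $ i * v $ i = 0"
    using assms by (simp add: scalar_prod_def sum_nonneg_eq_0_iff)
  then show "v = 0\<^sub>v n" using assms by auto
qed (use assms in auto)

lemma scalar_prod_self_pos:
  assumes "(v :: real vec) \<in> carrier_vec n" "v \<noteq> 0\<^sub>v n"
  shows "v \<bullet> v > 0"
  using scalar_prod_self_nonneg[of v] scalar_prod_self_eq_0[OF assms(1)] assms(2) by linarith

lemma eq_matI_mult_vec:
  fixes A B :: "'a :: comm_ring_1 mat"
  assumes A: "A \<in> carrier_mat m n" and B: "B \<in> carrier_mat m n"
    and eq: "\<And>v. v \<in> carrier_vec n \<Longrightarrow> A *\<^sub>v v = B *\<^sub>v v"
  shows "A = B"
proof (rule eq_matI)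
  fix i j assume "i < dim_row B" "j < dim_col B"
  then show "A $$ (i, j) = B $$ (i, j)"
    using arg_cong[OF eq[of "unit_vec n j"], of "\<lambda>v. v $ i"] A B by auto
qed (use A B in auto)

lemma transpose_smult_mat: "transpose_mat (c \<cdot>\<^sub>m A) = c \<cdot>\<^sub>m transpose_mat A"
  by (rule eq_matI) auto

lemma symmetric_scalar_prod:
  assumes "(A :: real mat) \<in> carrier_mat n n" "transpose_mat A = A" "v \<in> carrier_vec n" "w \<in> carrier_vec n"
  shows "v \<bullet> (A *\<^sub>v w) = (A *\<^sub>v v) \<bullet> w"
  using transpose_vec_mult_scalar[OF assms(1,4,3)] assms by metis

section \<open>Square roots of positive semidefinite matrices\<close>

text \<open>Semidefiniteness is the notion that survives the removal of an eigenvector: the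
  remainder has a nontrivial kernel even if the original matrix is definite.\<close>

definition psd_mat :: "nat \<Rightarrow> real mat \<Rightarrow> bool" where
  "psd_mat n A \<longleftrightarrow> A \<in> carrier_mat n n \<and> transpose_mat A = A \<and>
    (\<forall>v \<in> carrier_vec n. v \<bullet> (A *\<^sub>v v) \<ge> 0)"

text \<open>The form at v + t w is a quadratic polynomial in t without negative values, which
  restricts its coefficients.\<close>

lemma psd_cauchy_schwarz:
  assumes A: "psd_mat n A" and v: "v \<in> carrier_vec n" and w: "w \<in> carrier_vec n"
  shows "(w \<bullet> (A *\<^sub>v v))\<^sup>2 \<le> (w \<bullet> (A *\<^sub>v w)) * (v \<bullet> (A *\<^sub>v v))"
proof -
  have AC: "A \<in> carrier_mat n n" and AT: "transpose_mat A = A"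
    and pos: "\<And>u. u \<in> carrier_vec n \<Longrightarrow> u \<bullet> (A *\<^sub>v u) \<ge> 0"
    using A by (auto simp: psd_mat_def)
  define a b c where "a = w \<bullet> (A *\<^sub>v w)" and "b = w \<bullet> (A *\<^sub>v v)" and "c = v \<bullet> (A *\<^sub>v v)"
  have sym: "v \<bullet> (A *\<^sub>v w) = b"
    using symmetric_scalar_prod[OF AC AT v w] comm_scalar_prod[of "A *\<^sub>v v" n w] AC v w
    by (simp add: b_def)
  have quad: "c + 2 * t * b + t\<^sup>2 * a \<ge> 0" for t
  proof -
    have [simp]: "A *\<^sub>v v \<in> carrier_vec n" "A *\<^sub>v w \<in> carrier_vec n" using AC v w by auto
    have "(v + t \<cdot>\<^sub>v w) \<bullet> (A *\<^sub>v (v + t \<cdot>\<^sub>v w)) = c + 2 * t * b + t\<^sup>2 * a"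
      using AC v w sym
      by (simp add: mult_add_distrib_mat_vec[OF AC] mult_mat_vec[OF AC] scalar_prod_add_distrib[of _ n]
          add_scalar_prod_distrib[of _ n] a_def b_def c_def power2_eq_square algebra_simps)
    then show ?thesis using pos[of "v + t \<cdot>\<^sub>v w"] v w by simp
  qed
  have "b\<^sup>2 \<le> a * c"
  proof (cases "a = 0")
    case True
    have "b = 0"
    proof (rule ccontr)
      assume "b \<noteq> 0"
      \<comment> \<open>Without its leading term the polynomial is linear in t; this t makes it
        equal to -1.\<close>
      then show False using quad[of "- (c + 1) / (2 * b)"] True by (simp add: field_simps)
    qed
    then show ?thesis using True by simp
  next
    case False
    then have "a > 0" using pos[OF w] a_def by simp
    \<comment> \<open>The minimizer of the quadratic polynomial.\<close>
    then show ?thesis using quad[of "- b / a"] by (simp add: field_simps power2_eq_square)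
  qed
  then show ?thesis by (simp add: a_def b_def c_def)
qed

text \<open>Cauchy-Schwarz for the pair A v, v bounds the square of (A v, A v) by a multiple of the
  form at v. This stands in for definiteness when only semidefiniteness is available.\<close>

lemma psd_form_zero_imp_kernel:
  assumes A: "psd_mat n A" and v: "v \<in> carrier_vec n" and z: "v \<bullet> (A *\<^sub>v v) = 0"
  shows "A *\<^sub>v v = 0\<^sub>v n"
proof -
  have c: "A *\<^sub>v v \<in> carrier_vec n" using A v by (auto simp: psd_mat_def)
  have "((A *\<^sub>v v) \<bullet> (A *\<^sub>v v))\<^sup>2 \<le> 0"
    using psd_cauchy_schwarz[OF A v c] z by simp
  then show ?thesis using scalar_prod_self_eq_0[OF c] by simp
qed

text \<open>If the supremum \<^term>\<open>l\<close> of the Rayleigh quotients were not an eigenvalue, then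
  \<^term>\<open>l \<cdot>\<^sub>m 1\<^sub>m n - A\<close> would be invertible, and the Cauchy-Schwarz inequality for its form would
  bound that form away from 0 on the unit sphere.\<close>

lemma psd_nonzero_eigenvector:
  assumes A: "psd_mat n A" and nz: "A \<noteq> 0\<^sub>m n n"
  obtains l v where "l > 0" "v \<in> carrier_vec n" "v \<bullet> v = 1" "A *\<^sub>v v = l \<cdot>\<^sub>v v"
proof -
  have AC: "A \<in> carrier_mat n n" and AT: "transpose_mat A = A"
    and pos: "\<And>u. u \<in> carrier_vec n \<Longrightarrow> u \<bullet> (A *\<^sub>v u) \<ge> 0"
    using A by (auto simp: psd_mat_def)
  \<comment> \<open>The zero vector is kept and contributes 0/0 = 0. This makes \<open>R\<close>
    nonempty in every dimension; in return, the value 0 needs separate treatment when the bound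
    \<open>l\<close> is improved below.\<close>
  define R where "R = (\<lambda>u. (u \<bullet> (A *\<^sub>v u)) / (u \<bullet> u)) ` carrier_vec n"
  define l where "l = Sup R"
  obtain K where K: "K \<ge> 0" "\<And>u. u \<in> carrier_vec n \<Longrightarrow> eucl_norm (A *\<^sub>v u) \<le> K * eucl_norm u"
    using eucl_norm_mult_mat_vec_bound[OF AC] by blast
  have "r \<le> K" if rR: "r \<in> R" for r
  proof -
    obtain u where u: "u \<in> carrier_vec n" and r: "r = (u \<bullet> (A *\<^sub>v u)) / (u \<bullet> u)"
      using rR by (auto simp: R_def)
    have "u \<bullet> (A *\<^sub>v u) \<le> eucl_norm u * eucl_norm (A *\<^sub>v u)"
      using scalar_prod_le_eucl_norm[of u n "A *\<^sub>v u"] u AC by auto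
    also have "\<dots> \<le> eucl_norm u * (K * eucl_norm u)"
      using K(2)[OF u] by (intro mult_left_mono) (auto simp: eucl_norm_nonneg)
    also have "\<dots> = K * (u \<bullet> u)"
      by (simp flip: eucl_norm_square add: power2_eq_square)
    finally show ?thesis
      using K(1) scalar_prod_self_nonneg[of u] unfolding r
      by (cases "u \<bullet> u = 0") (auto simp: divide_simps)
  qed
  then have bdd: "bdd_above R" by (auto simp: bdd_above_def)
  have upper: "u \<bullet> (A *\<^sub>v u) \<le> l * (u \<bullet> u)" if u: "u \<in> carrier_vec n" for u
  proof (cases "u = 0\<^sub>v n")
    case True
    then show ?thesis using AC u by simp
  next
    case False
    have "(u \<bullet> (A *\<^sub>v u)) / (u \<bullet> u) \<le> l"
      unfolding l_def using bdd u by (intro cSup_upper) (auto simp: R_def)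
    then show ?thesis using scalar_prod_self_pos[OF u False] by (simp add: divide_simps mult.commute)
  qed
  have lpos: "l > 0"
  proof (rule ccontr)
    assume "\<not> l > 0"
    \<comment> \<open>The form at u lies between 0 and l (u, u), so it vanishes for every u if l is
      not positive.\<close>
    have "A *\<^sub>v u = 0\<^sub>m n n *\<^sub>v u" if u: "u \<in> carrier_vec n" for u
    proof -
      have "l * (u \<bullet> u) \<le> 0"
        using \<open>\<not> l > 0\<close> scalar_prod_self_nonneg[of u] by (simp add: mult_nonpos_nonneg)
      then have "u \<bullet> (A *\<^sub>v u) = 0" using upper[OF u] pos[OF u] by linarith
      then have "A *\<^sub>v u = 0\<^sub>v n" by (rule psd_form_zero_imp_kernel[OF A u])
      then show ?thesis using u by (intro eq_vecI) auto
    qed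
    then show False using nz eq_matI_mult_vec[OF AC zero_carrier_mat] by blast
  qed
  define L where "L = l \<cdot>\<^sub>m 1\<^sub>m n - A"
  have LC: "L \<in> carrier_mat n n" using AC by (simp add: L_def minus_carrier_mat)
  have Lv: "L *\<^sub>v u = l \<cdot>\<^sub>v u - A *\<^sub>v u" if u: "u \<in> carrier_vec n" for u
  proof -
    have "l \<cdot>\<^sub>m 1\<^sub>m n *\<^sub>v u = l \<cdot>\<^sub>v u" using u by (intro eq_vecI) auto
    then show ?thesis unfolding L_def using u AC by (subst minus_mult_distrib_mat_vec) auto
  qed
  have Lform: "u \<bullet> (L *\<^sub>v u) = l * (u \<bullet> u) - u \<bullet> (A *\<^sub>v u)" if u: "u \<in> carrier_vec n" for u
    using u AC by (simp add: Lv scalar_prod_minus_distrib[of _ n])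
  have Lpsd: "psd_mat n L"
    unfolding psd_mat_def
  proof (intro conjI ballI)
    show "transpose_mat L = L"
      using AC AT unfolding L_def by (subst transpose_minus) (auto simp: transpose_smult_mat)
  qed (use LC Lform upper in auto)
  have "det L = 0"
  proof (rule ccontr)
    assume "det L \<noteq> 0"
    then obtain T where TC: "T \<in> carrier_mat n n" and LT: "L * T = 1\<^sub>m n"
      using det_non_zero_imp_unit[OF LC, of "()"] LC
      by (auto simp: Units_def ring_mat_def)
    obtain C where C: "C \<ge> 0" "\<And>u. u \<in> carrier_vec n \<Longrightarrow> eucl_norm (T *\<^sub>v u) \<le> C * eucl_norm u"
      using eucl_norm_mult_mat_vec_bound[OF TC] by blast
    \<comment> \<open>Cauchy-Schwarz for the form of \<open>L\<close> is applied to u and T u. Since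
      L (T u) = u, the mixed term is (u, u), and the form at T u is (T u, u), at most C (u, u). One
      factor (u, u) then cancels.\<close>
    have gap: "u \<bullet> u \<le> C * (u \<bullet> (L *\<^sub>v u))" if u: "u \<in> carrier_vec n" for u
    proof (cases "u = 0\<^sub>v n")
      case True
      then show ?thesis using LC u by simp
    next
      case False
      have Tu: "T *\<^sub>v u \<in> carrier_vec n" using TC u by auto
      have LTu: "L *\<^sub>v (T *\<^sub>v u) = u"
        using assoc_mult_mat_vec[OF LC TC u] LT u by simp
      have "(u \<bullet> u)\<^sup>2 \<le> ((T *\<^sub>v u) \<bullet> u) * (u \<bullet> (L *\<^sub>v u))"
        using psd_cauchy_schwarz[OF Lpsd u Tu] symmetric_scalar_prod[OF LC _ Tu u] Lpsd LTu
        by (simp add: psd_mat_def)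
      also have "(T *\<^sub>v u) \<bullet> u \<le> (C * eucl_norm u) * eucl_norm u"
        using scalar_prod_le_eucl_norm[OF Tu u] C(2)[OF u] eucl_norm_nonneg[of u]
        by (smt (verit) mult_right_mono)
      also have "(C * eucl_norm u) * eucl_norm u = C * (u \<bullet> u)"
        by (simp flip: eucl_norm_square add: power2_eq_square)
      finally have "(u \<bullet> u) * (u \<bullet> u) \<le> (u \<bullet> u) * (C * (u \<bullet> (L *\<^sub>v u)))"
        using Lpsd u by (simp add: psd_mat_def power2_eq_square mult_right_mono ac_simps)
      then show ?thesis using scalar_prod_self_pos[OF u False] by simp
    qed
    \<comment> \<open>\<open>C\<close> may be zero, and the improved bound divides by the
      constant.\<close>
    define D where "D = C + 1"
    have "D > 0" using C by (simp add: D_def)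
    have "r \<le> l - 1 / D" if rR: "r \<in> R" "r \<noteq> 0" for r
    proof -
      obtain u where u: "u \<in> carrier_vec n" and r: "r = (u \<bullet> (A *\<^sub>v u)) / (u \<bullet> u)"
        using rR by (auto simp: R_def)
      have uu: "u \<bullet> u > 0"
        using \<open>r \<noteq> 0\<close> scalar_prod_self_nonneg[of u] unfolding r by (cases "u \<bullet> u = 0") auto
      have "u \<bullet> u \<le> D * (u \<bullet> (L *\<^sub>v u))"
        using gap[OF u] Lpsd u by (simp add: D_def psd_mat_def distrib_right add_increasing2)
      then have "u \<bullet> u \<le> D * (l * (u \<bullet> u) - u \<bullet> (A *\<^sub>v u))" using Lform[OF u] by simp
      then show ?thesis
        using uu \<open>D > 0\<close> unfolding r by (simp add: field_simps)
    qed
    \<comment> \<open>The maximum with 0 takes care of the zero quotients. As l > 0, the new bound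
      still lies strictly below the supremum.\<close>
    then have "r \<le> max 0 (l - 1 / D)" if "r \<in> R" for r
      using that by (cases "r = 0") (auto intro: max.coboundedI2)
    then have "l \<le> max 0 (l - 1 / D)"
      unfolding l_def by (intro cSup_least) (use zero_carrier_vec[of n] in \<open>auto simp: R_def simp del: zero_carrier_vec\<close>)
    then show False using lpos \<open>D > 0\<close> by (auto simp: max_def split: if_splits)
  qed
  then obtain u where u: "u \<in> carrier_vec n" "u \<noteq> 0\<^sub>v n" "L *\<^sub>v u = 0\<^sub>v n"
    using det_0_iff_vec_prod_zero_field[OF LC] by blast
  define s where "s = 1 / eucl_norm u"
  have un: "eucl_norm u > 0"
    using scalar_prod_self_pos[OF u(1,2)] eucl_norm_nonneg[of u] by (simp flip: eucl_norm_square)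
  have "A *\<^sub>v u = l \<cdot>\<^sub>v u"
  proof (rule eq_vecI)
    fix i assume i: "i < dim_vec (l \<cdot>\<^sub>v u)"
    have "(l \<cdot>\<^sub>v u - A *\<^sub>v u) $ i = 0" using i u Lv[OF u(1)] by simp
    then show "(A *\<^sub>v u) $ i = (l \<cdot>\<^sub>v u) $ i" using i u AC by simp
  qed (use u AC in auto)
  then have "A *\<^sub>v (s \<cdot>\<^sub>v u) = l \<cdot>\<^sub>v (s \<cdot>\<^sub>v u)"
    using u AC by (simp add: mult_mat_vec[OF AC] smult_smult_assoc mult.commute)
  moreover have "(s \<cdot>\<^sub>v u) \<bullet> (s \<cdot>\<^sub>v u) = 1"
    using u scalar_prod_self_pos[OF u(1,2)] eucl_norm_square[of u] by (simp add: s_def power2_eq_square)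
  ultimately show thesis using that lpos u by (metis smult_carrier_vec)
qed

section \<open>Rank-one deflation and existence of the square root\<close>

definition outer_square :: "nat \<Rightarrow> real vec \<Rightarrow> real mat" where
  "outer_square n v = mat n n (\<lambda>(i, j). v $ i * v $ j)"

lemma outer_square_carrier [simp]: "outer_square n v \<in> carrier_mat n n"
  by (simp add: outer_square_def)

lemma outer_square_transpose: "transpose_mat (outer_square n v) = outer_square n v"
  by (auto simp: outer_square_def)

lemma outer_square_mult_vec:
  assumes "v \<in> carrier_vec n" "w \<in> carrier_vec n"
  shows "outer_square n v *\<^sub>v w = (v \<bullet> w) \<cdot>\<^sub>v v"
  using assms by (auto simp: outer_square_def scalar_prod_def sum_distrib_left sum_distrib_right ac_simps intro!: eq_vecI sum.cong)

text \<open>The span of U stays inside the kernel, so a vector outside the kernel is independent of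
  U. The bound by n guarantees that \<open>n - card U\<close> really decreases when a deflation step
  adds its eigenvector to U.\<close>

lemma card_linearly_independent_kernel_insert:
  assumes A: "(A :: real mat) \<in> carrier_mat n n"
    and U: "U \<subseteq> mat_kernel A" "finite U" "\<not> module.lin_dep class_ring (module_vec TYPE(real) n) U"
    and v: "v \<in> carrier_vec n" "v \<notin> mat_kernel A"
  shows "\<not> module.lin_dep class_ring (module_vec TYPE(real) n) (insert v U)" "card (insert v U) \<le> n"
    "card (insert v U) = Suc (card U)"
proof -
  interpret kernel n n A by (unfold_locales, rule A)
  have UC: "U \<subseteq> carrier_vec n" using U(1) mat_kernel_carrier[OF A] by auto
  have "NC.span U \<subseteq> mat_kernel A"
    using span_same[OF U(1)] Ker.span_is_subset2[OF U(1)] by simp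
  then have "v \<notin> NC.span U" using v by auto
  then show li: "\<not> NC.lin_dep (insert v U)"
    using NC.lin_dep_iff_in_span[of U v] UC U v by auto
  show "card (insert v U) \<le> n"
    using NC.li_le_dim(2)[OF NC.fin_dim _ li] UC v NC.dim_is_n by auto
  show "card (insert v U) = Suc (card U)"
    using U(1,2) v(2) by (metis card_insert_disjoint subsetD)
qed

text \<open>Removing an eigenvalue \<^term>\<open>l > 0\<close> with unit eigenvector \<^term>\<open>v\<close> from \<^term>\<open>A\<close> enlarges the kernel,
  and \<^term>\<open>sqrt l\<close> times the projection onto \<^term>\<open>v\<close> repairs the square root of the remainder.\<close>

lemma psd_sqrt_exists:
  assumes "psd_mat n A"
  obtains B where "psd_mat n B" "B * B = A"
proof -
  \<comment> \<open>The claim carries an independent set U of kernel vectors, so that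
    \<open>n - card U\<close> can serve as the induction measure. At the end it is used with the
    empty set.\<close>
  have "\<exists>B. psd_mat n B \<and> B * B = A"
    if "psd_mat n A" "U \<subseteq> mat_kernel A" "finite U"
      "\<not> module.lin_dep class_ring (module_vec TYPE(real) n) U" for U
    using that
  proof (induction "n - card U" arbitrary: A U rule: less_induct)
    case less
    have AC: "A \<in> carrier_mat n n" and AT: "transpose_mat A = A"
      and pos: "\<And>u. u \<in> carrier_vec n \<Longrightarrow> u \<bullet> (A *\<^sub>v u) \<ge> 0"
      using less.prems(1) by (auto simp: psd_mat_def)
    show ?case
    proof (cases "A = 0\<^sub>m n n")
      case True
      then show ?thesis using less.prems(1) by (intro exI[of _ "0\<^sub>m n n"]) simp
    next
      case False
      then obtain l v where l: "l > 0" and v: "v \<in> carrier_vec n" and vv: "v \<bullet> v = 1"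
        and ev: "A *\<^sub>v v = l \<cdot>\<^sub>v v"
        using psd_nonzero_eigenvector[OF less.prems(1)] by metis
      define A' where "A' = A - l \<cdot>\<^sub>m outer_square n v"
      have A'C: "A' \<in> carrier_mat n n" using AC by (simp add: A'_def minus_carrier_mat)
      have outer: "(c \<cdot>\<^sub>m outer_square n v) *\<^sub>v w = (c * (v \<bullet> w)) \<cdot>\<^sub>v v" if w: "w \<in> carrier_vec n" for c w
      proof -
        have "(c \<cdot>\<^sub>m outer_square n v) *\<^sub>v w = c \<cdot>\<^sub>v (outer_square n v *\<^sub>v w)"
          using w by (auto simp: outer_square_def scalar_prod_def sum_distrib_left ac_simps intro!: eq_vecI)
        then show ?thesis using outer_square_mult_vec[OF v w] by (simp add: smult_smult_assoc)
      qed
      have A'v: "A' *\<^sub>v w = A *\<^sub>v w - (l * (v \<bullet> w)) \<cdot>\<^sub>v v" if w: "w \<in> carrier_vec n" for w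
        unfolding A'_def using w AC outer[OF w] by (subst minus_mult_distrib_mat_vec[of _ n n]) auto
      have vA: "v \<bullet> (A *\<^sub>v w) = l * (v \<bullet> w)" if w: "w \<in> carrier_vec n" for w
        using symmetric_scalar_prod[OF AC AT v w] ev v w by simp
      have psd': "psd_mat n A'"
        unfolding psd_mat_def
      proof (intro conjI ballI)
        show "transpose_mat A' = A'"
          using AC AT unfolding A'_def
          by (subst transpose_minus) (auto simp: transpose_smult_mat outer_square_transpose)
        fix w :: "real vec" assume w: "w \<in> carrier_vec n"
        \<comment> \<open>With A v = l v and (v, v) = 1, Cauchy-Schwarz becomes l (v, w)^2 \<le> (w,
          A w) after cancelling l. So the removed part never exceeds the form of
          \<open>A\<close>.\<close>
        have "(v \<bullet> (A *\<^sub>v w))\<^sup>2 \<le> (v \<bullet> (A *\<^sub>v v)) * (w \<bullet> (A *\<^sub>v w))"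
          using psd_cauchy_schwarz[OF less.prems(1) w v] .
        then have "l * (l * (v \<bullet> w)\<^sup>2) \<le> l * (w \<bullet> (A *\<^sub>v w))"
          using vA[OF w] ev vv v by (simp add: power2_eq_square ac_simps)
        then have "l * (v \<bullet> w)\<^sup>2 \<le> w \<bullet> (A *\<^sub>v w)" using l by simp
        moreover have "w \<bullet> (A' *\<^sub>v w) = w \<bullet> (A *\<^sub>v w) - l * (v \<bullet> w)\<^sup>2"
          using w v AC comm_scalar_prod[OF v w]
          by (simp add: A'v scalar_prod_minus_distrib[of _ n] power2_eq_square)
        ultimately show "w \<bullet> (A' *\<^sub>v w) \<ge> 0" by simp
      qed (rule A'C)
      have A'v0: "A' *\<^sub>v v = 0\<^sub>v n" using A'v[OF v] ev vv v by (intro eq_vecI) auto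
      have vU: "v \<notin> mat_kernel A"
      proof
        assume "v \<in> mat_kernel A"
        then have "v \<bullet> (A *\<^sub>v v) = 0" using mat_kernelD[OF AC] v by auto
        then show False using vA[OF v] vv l by simp
      qed
      \<comment> \<open>Kernel vectors of \<open>A\<close> are orthogonal to v, because l (v, w) =
        (v, A w) = 0. Hence the deflation leaves them in the kernel.\<close>
      have "w \<in> mat_kernel A'" if wU: "w \<in> U" for w
      proof -
        have w: "w \<in> carrier_vec n" "A *\<^sub>v w = 0\<^sub>v n"
          using less.prems(2) wU mat_kernelD[OF AC] by auto
        then have "v \<bullet> w = 0" using vA[OF w(1)] l v by simp
        then have "A' *\<^sub>v w = 0\<^sub>v n" using A'v[OF w(1)] w v by (intro eq_vecI) auto
        then show ?thesis using mat_kernelI[OF A'C] w by blast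
      qed
      then have ker': "insert v U \<subseteq> mat_kernel A'"
        using mat_kernelI[OF A'C v A'v0] by auto
      note ins = card_linearly_independent_kernel_insert[OF AC less.prems(2-4) v vU]
      have "n - card (insert v U) < n - card U" using ins by linarith
      then obtain B' where B': "psd_mat n B'" "B' * B' = A'"
        using less.hyps[OF _ psd' ker' _ ins(1)] less.prems(3) by auto
      have B'C: "B' \<in> carrier_mat n n" and B'T: "transpose_mat B' = B'" using B' by (auto simp: psd_mat_def)
      \<comment> \<open>The squared length of B' v is the form of \<open>A'\<close> at v, which is
        zero. So B' v = 0, and the cross terms in the square of \<open>B\<close> vanish.\<close>
      have "(B' *\<^sub>v v) \<bullet> (B' *\<^sub>v v) = v \<bullet> (A' *\<^sub>v v)"
        using symmetric_scalar_prod[OF B'C B'T v, of "B' *\<^sub>v v"] B'C v B'(2) by (metis assoc_mult_mat_vec mult_mat_vec_carrier)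
      then have "(B' *\<^sub>v v) \<bullet> (B' *\<^sub>v v) = 0" using A'v0 v by simp
      then have B'v: "B' *\<^sub>v v = 0\<^sub>v n"
        using scalar_prod_self_eq_0[of "B' *\<^sub>v v" n] B'C v by auto
      have vB': "v \<bullet> (B' *\<^sub>v w) = 0" if w: "w \<in> carrier_vec n" for w
        using symmetric_scalar_prod[OF B'C B'T v w] B'v w by simp
      define B where "B = B' + sqrt l \<cdot>\<^sub>m outer_square n v"
      have BC: "B \<in> carrier_mat n n" using B'C by (simp add: B_def)
      have Bv: "B *\<^sub>v w = B' *\<^sub>v w + (sqrt l * (v \<bullet> w)) \<cdot>\<^sub>v v" if w: "w \<in> carrier_vec n" for w
        unfolding B_def using w B'C outer[OF w] by (subst add_mult_distrib_mat_vec[of _ n n]) auto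
      have "B * B = A"
      proof (rule eq_matI_mult_vec)
        fix w :: "real vec" assume w: "w \<in> carrier_vec n"
        define c where "c = sqrt l * (v \<bullet> w)"
        have B'w: "B' *\<^sub>v w \<in> carrier_vec n" using B'C w by auto
        have Bw: "B *\<^sub>v w \<in> carrier_vec n" using BC w by auto
        have 1: "B' *\<^sub>v (B *\<^sub>v w) = A' *\<^sub>v w"
        proof -
          have "B' *\<^sub>v (B *\<^sub>v w) = B' *\<^sub>v (B' *\<^sub>v w) + c \<cdot>\<^sub>v (B' *\<^sub>v v)"
            using B'w v w unfolding Bv[OF w] c_def[symmetric]
            by (simp add: mult_add_distrib_mat_vec[OF B'C] mult_mat_vec[OF B'C])
          also have "\<dots> = A' *\<^sub>v w"
            using B'C w B'w unfolding B'v B'(2)[symmetric] by (intro eq_vecI) auto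
          finally show ?thesis .
        qed
        have 2: "v \<bullet> (B *\<^sub>v w) = c"
          unfolding Bv[OF w] using B'w v vB'[OF w] vv by (simp add: scalar_prod_add_distrib[of _ n] c_def)
        have "B * B *\<^sub>v w = B *\<^sub>v (B *\<^sub>v w)" using BC w by simp
        also have "\<dots> = A' *\<^sub>v w + (sqrt l * c) \<cdot>\<^sub>v v" unfolding Bv[OF Bw] 1 2 ..
        also have "sqrt l * c = l * (v \<bullet> w)" using l by (simp add: c_def)
        also have "A' *\<^sub>v w + (l * (v \<bullet> w)) \<cdot>\<^sub>v v = A *\<^sub>v w"
          unfolding A'v[OF w] using AC w v by (intro eq_vecI) auto
        finally show "B * B *\<^sub>v w = A *\<^sub>v w" .
      qed (use BC AC in auto)
      moreover have "psd_mat n B"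
        unfolding psd_mat_def
      proof (intro conjI ballI)
        show "transpose_mat B = B"
          using B'C B'T unfolding B_def
          by (subst transpose_add) (auto simp: transpose_smult_mat outer_square_transpose)
        fix w :: "real vec" assume w: "w \<in> carrier_vec n"
        have "w \<bullet> (B *\<^sub>v w) = w \<bullet> (B' *\<^sub>v w) + sqrt l * (v \<bullet> w)\<^sup>2"
          using w v B'C comm_scalar_prod[OF v w]
          by (simp add: Bv scalar_prod_add_distrib[of _ n] power2_eq_square)
        then show "w \<bullet> (B *\<^sub>v w) \<ge> 0" using B'(1) w l by (simp add: psd_mat_def)
      qed (rule BC)
      ultimately show ?thesis by blast
    qed
  qed
  moreover have "\<not> module.lin_dep class_ring (module_vec TYPE(real) n) {}"
  proof -
    interpret vec_space "TYPE(real)" n .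
    show ?thesis by (simp add: lin_dep_def)
  qed
  ultimately show ?thesis using that assms by (metis empty_subsetI finite.emptyI)
qed

lemma spd_mat_imp_psd: "spd_mat A \<Longrightarrow> A \<in> carrier_mat n n \<Longrightarrow> psd_mat n A"
  unfolding spd_mat_def psd_mat_def
  by (metis carrier_matD(1) less_eq_real_def mult_mat_vec_carrier scalar_prod_left_zero)

text \<open>A semidefinite root of a definite matrix is definite, since a vector killed by the root
  is killed by its square. This supplies the witness that makes the choice in
  \<open>sqrt_mat\<close> meaningful.\<close>

lemma sqrt_mat_props:
  assumes A: "A \<in> carrier_mat n n" and spd: "spd_mat A"
  shows "sqrt_mat A \<in> carrier_mat n n" "spd_mat (sqrt_mat A)" "sqrt_mat A * sqrt_mat A = A"
proof -
  obtain B where B: "psd_mat n B" "B * B = A"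
    using psd_sqrt_exists[OF spd_mat_imp_psd[OF spd A]] .
  have BC: "B \<in> carrier_mat n n" and BT: "transpose_mat B = B" using B by (auto simp: psd_mat_def)
  have "v \<bullet> (B *\<^sub>v v) > 0" if v: "v \<in> carrier_vec n" "v \<noteq> 0\<^sub>v n" for v
  proof (rule ccontr)
    assume "\<not> v \<bullet> (B *\<^sub>v v) > 0"
    then have "v \<bullet> (B *\<^sub>v v) = 0" using B(1) v by (force simp: psd_mat_def)
    then have "B *\<^sub>v v = 0\<^sub>v n" by (rule psd_form_zero_imp_kernel[OF B(1) v(1)])
    then have "A *\<^sub>v v = 0\<^sub>v n" using BC v unfolding B(2)[symmetric] by auto
    then show False using spd v A by (auto simp: spd_mat_def)
  qed
  then have "spd_mat B" using BC BT by (auto simp: spd_mat_def)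
  then have "\<exists>B. B \<in> carrier_mat (dim_row A) (dim_row A) \<and> spd_mat B \<and> B * B = A"
    using BC B(2) A by auto
  from someI_ex[OF this] show "sqrt_mat A \<in> carrier_mat n n" "spd_mat (sqrt_mat A)" "sqrt_mat A * sqrt_mat A = A"
    using A unfolding sqrt_mat_def by auto
qed

section \<open>Energy norms\<close>

text \<open>Symmetry moves one factor of the root to the other side. Identities between energy norms
  can then be checked on quadratic forms, where the Galerkin condition applies directly.\<close>

lemma energy_norm_square:
  assumes A: "A \<in> carrier_mat n n" and spd: "spd_mat A" and v: "v \<in> carrier_vec n"
  shows "(energy_norm A v)\<^sup>2 = v \<bullet> (A *\<^sub>v v)"
proof -
  note S = sqrt_mat_props[OF A spd]
  have Sv: "sqrt_mat A *\<^sub>v v \<in> carrier_vec n" using S v by auto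
  have "v \<bullet> (A *\<^sub>v v) = v \<bullet> (sqrt_mat A *\<^sub>v (sqrt_mat A *\<^sub>v v))"
    using assoc_mult_mat_vec[OF S(1,1) v] S(3) by simp
  also have "\<dots> = (sqrt_mat A *\<^sub>v v) \<bullet> (sqrt_mat A *\<^sub>v v)"
    using symmetric_scalar_prod[OF S(1) _ v Sv] S(2) by (simp add: spd_mat_def)
  finally show ?thesis by (simp add: energy_norm_def eucl_norm_square)
qed

lemma energy_norm_nonneg: "energy_norm A v \<ge> 0"
  by (simp add: energy_norm_def eucl_norm_nonneg)

lemma energy_norm_zero:
  assumes "A \<in> carrier_mat n n" "spd_mat A"
  shows "energy_norm A (0\<^sub>v n) = 0"
  using energy_norm_square[OF assms zero_carrier_vec] assms(1) by simp

lemma energy_norm_pos: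
  assumes "A \<in> carrier_mat n n" "spd_mat A" "v \<in> carrier_vec n" "v \<noteq> 0\<^sub>v n"
  shows "energy_norm A v > 0"
  using energy_norm_square[OF assms(1-3)] assms energy_norm_nonneg[of A v]
  by (metis carrier_matD(1) less_eq_real_def order_less_irrefl spd_mat_def zero_power2)

lemma energy_norm_triangle:
  assumes A: "A \<in> carrier_mat n n" "spd_mat A" and "v \<in> carrier_vec n" "w \<in> carrier_vec n"
  shows "energy_norm A (v + w) \<le> energy_norm A v + energy_norm A w"
proof -
  note S = sqrt_mat_props[OF A]
  show ?thesis
    unfolding energy_norm_def mult_add_distrib_mat_vec[OF S(1) assms(3,4)]
    by (rule eucl_norm_triangle[of _ n]) (use S assms in auto)
qed

section \<open>Inverses and the induced energy norm\<close>

lemma spd_mat_det_nonzero: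
  assumes A: "A \<in> carrier_mat n n" and "spd_mat A"
  shows "det A \<noteq> 0"
proof
  assume "det A = 0"
  then obtain v where "v \<in> carrier_vec n" "v \<noteq> 0\<^sub>v n" "A *\<^sub>v v = 0\<^sub>v n"
    using det_0_iff_vec_prod_zero_field[OF A] by blast
  then show False using assms by (auto simp: spd_mat_def)
qed

text \<open>A nonzero determinant makes \<open>mat_inverse\<close> return \<open>Some\<close>, so
  \<open>the\<close> in \<open>mat_inv\<close> yields a genuine inverse.\<close>

lemma mat_inv_props:
  assumes A: "A \<in> carrier_mat n n" and "spd_mat A"
  shows "mat_inv A \<in> carrier_mat n n" "mat_inv A * A = 1\<^sub>m n"
proof -
  have "A \<in> Units (ring_mat TYPE(real) n ())"
    using det_non_zero_imp_unit[OF A spd_mat_det_nonzero[OF assms]] .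
  then obtain B where "mat_inverse A = Some B"
    using mat_inverse(1)[OF A, where b = "()"] by (cases "mat_inverse A") auto
  then show "mat_inv A \<in> carrier_mat n n" "mat_inv A * A = 1\<^sub>m n"
    using mat_inverse(2)[OF A] by (auto simp: mat_inv_def)
qed

text \<open>Substituting w for the root of A applied to v turns the quotients into Euclidean ones
  for \<open>Q\<close>, the conjugate of B by the root. Boundedness is what lets the real supremum
  act as an upper bound.\<close>

lemma energy_mat_norm_bdd_above:
  assumes A: "A \<in> carrier_mat n n" "spd_mat A" and B: "B \<in> carrier_mat n n"
  shows "bdd_above ((\<lambda>v. energy_norm A (B *\<^sub>v v) / energy_norm A v) ` carrier_vec (dim_col B))"
proof -
  note S = sqrt_mat_props[OF A]
  define T where "T = mat_inv (sqrt_mat A)"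
  have TC: "T \<in> carrier_mat n n" and TS: "T * sqrt_mat A = 1\<^sub>m n"
    using mat_inv_props[OF S(1,2)] by (auto simp: T_def)
  define Q where "Q = sqrt_mat A * B * T"
  have QC: "Q \<in> carrier_mat n n" using S B TC by (auto simp: Q_def)
  obtain K where K: "K \<ge> 0" "\<And>u. u \<in> carrier_vec n \<Longrightarrow> eucl_norm (Q *\<^sub>v u) \<le> K * eucl_norm u"
    using eucl_norm_mult_mat_vec_bound[OF QC] by blast
  have "energy_norm A (B *\<^sub>v v) / energy_norm A v \<le> K" if v: "v \<in> carrier_vec n" for v
  proof -
    have Sv: "sqrt_mat A *\<^sub>v v \<in> carrier_vec n" using S v by auto
    have TSv: "T *\<^sub>v (sqrt_mat A *\<^sub>v v) = v"
      using assoc_mult_mat_vec[OF TC S(1) v] TS v by simp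
    have SB: "sqrt_mat A * B \<in> carrier_mat n n" using S B by auto
    have "Q *\<^sub>v (sqrt_mat A *\<^sub>v v) = sqrt_mat A *\<^sub>v (B *\<^sub>v v)"
      unfolding Q_def assoc_mult_mat_vec[OF SB TC Sv] TSv assoc_mult_mat_vec[OF S(1) B v] ..
    then have "energy_norm A (B *\<^sub>v v) \<le> K * energy_norm A v"
      using K(2)[OF Sv] by (simp add: energy_norm_def)
    then show ?thesis using K(1) energy_norm_nonneg[of A v]
      by (cases "energy_norm A v = 0") (auto simp: divide_simps)
  qed
  then show ?thesis using B by (auto simp: bdd_above_def)
qed

lemma energy_norm_mult_mat_vec_le:
  assumes A: "A \<in> carrier_mat n n" "spd_mat A" and B: "B \<in> carrier_mat n n" and v: "v \<in> carrier_vec n"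
  shows "energy_norm A (B *\<^sub>v v) \<le> energy_mat_norm A B * energy_norm A v"
proof (cases "v = 0\<^sub>v n")
  case True
  have "B *\<^sub>v v = 0\<^sub>v n" using True B by (intro eq_vecI) auto
  then show ?thesis using True energy_norm_zero[OF A] by simp
next
  case False
  have "energy_norm A (B *\<^sub>v v) / energy_norm A v \<le> energy_mat_norm A B"
    unfolding energy_mat_norm_def using B v
    by (intro cSUP_upper energy_mat_norm_bdd_above[OF A B]) auto
  then show ?thesis using energy_norm_pos[OF A v False] by (simp add: divide_simps mult.commute)
qed

text \<open>The quotient at the zero vector is 0/0 = 0 and takes part in the supremum.\<close>

lemma energy_mat_norm_nonneg:
  assumes A: "A \<in> carrier_mat n n" "spd_mat A" and B: "B \<in> carrier_mat n n"
  shows "energy_mat_norm A B \<ge> 0"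
proof -
  have "energy_norm A (B *\<^sub>v 0\<^sub>v n) / energy_norm A (0\<^sub>v n) \<le> energy_mat_norm A B"
    unfolding energy_mat_norm_def using B
    by (intro cSUP_upper energy_mat_norm_bdd_above[OF A B]) auto
  then show ?thesis using energy_norm_zero[OF A] by simp
qed

section \<open>Prolongations of full rank and Galerkin matrices\<close>

text \<open>Linear independence is a property of the set of columns and cannot see a repeated
  column. A maximal independent subset already has m elements, so the m columns are distinct, and a
  nonzero kernel vector would be a linear dependence among them.\<close>

lemma full_column_rank_imp_injective:
  assumes P: "(P :: real mat) \<in> carrier_mat n m" and rank: "vec_space.rank n P = m"
    and v: "v \<in> carrier_vec m" "P *\<^sub>v v = 0\<^sub>v n"
  shows "v = 0\<^sub>v m"
proof (rule ccontr)
  assume nz: "v \<noteq> 0\<^sub>v m"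
  interpret vec_space "TYPE(real)" n .
  obtain T where T: "maximal T (\<lambda>T. T \<subseteq> set (cols P) \<and> lin_indpt T)"
    using maximal_exists[of "(\<lambda>T. T \<subseteq> set (cols P) \<and> lin_indpt T)" "card (set (cols P))" "{}"]
    by (meson List.finite_set card_mono empty_iff empty_subsetI finite_lin_indpt2 rev_finite_subset)
  have "m \<le> card (set (cols P))"
    using rank rank_card_indpt[OF P T] T card_mono[OF finite_set, of T "cols P"] by (simp add: maximal_def)
  then have dist: "distinct (cols P)"
    using P card_length[of "cols P"] by (intro card_distinct) auto
  show False
    using full_rank_lin_indpt[OF P rank dist] lin_depI[OF P v(1) nz v(2) dist] by blast
qed

lemma galerkin_form:
  assumes A: "(A :: real mat) \<in> carrier_mat n n" and P: "P \<in> carrier_mat n m" and v: "v \<in> carrier_vec m"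
  shows "v \<bullet> ((transpose_mat P * A * P) *\<^sub>v v) = (P *\<^sub>v v) \<bullet> (A *\<^sub>v (P *\<^sub>v v))"
proof -
  have Pv: "P *\<^sub>v v \<in> carrier_vec n" and PT: "transpose_mat P \<in> carrier_mat m n"
    and APv: "A *\<^sub>v (P *\<^sub>v v) \<in> carrier_vec n"
    using A P v by auto
  have "(transpose_mat P * A * P) *\<^sub>v v = transpose_mat P *\<^sub>v (A *\<^sub>v (P *\<^sub>v v))"
    using assoc_mult_mat_vec[OF mult_carrier_mat[OF PT A] P v] assoc_mult_mat_vec[OF PT A Pv] by simp
  moreover have "v \<bullet> (transpose_mat P *\<^sub>v (A *\<^sub>v (P *\<^sub>v v))) = (transpose_mat P *\<^sub>v (A *\<^sub>v (P *\<^sub>v v))) \<bullet> v"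
    using PT APv v by (intro comm_scalar_prod[of _ m]) auto
  moreover have "\<dots> = (P *\<^sub>v v) \<bullet> (A *\<^sub>v (P *\<^sub>v v))"
    using transpose_vec_mult_scalar[OF P v APv] comm_scalar_prod[OF APv Pv] by simp
  ultimately show ?thesis by simp
qed

text \<open>The form of the coarse matrix at v is the form of \<open>A\<close> at P v, and P v is
  nonzero for nonzero v because P is injective.\<close>

lemma spd_mat_galerkin:
  assumes A: "A \<in> carrier_mat n n" "spd_mat A" and P: "P \<in> carrier_mat n m"
    and rank: "vec_space.rank n P = m"
  shows "spd_mat (transpose_mat P * A * P)"
  unfolding spd_mat_def
proof (intro conjI ballI impI)
  have PT: "transpose_mat P \<in> carrier_mat m n" using P by simp
  have "transpose_mat (transpose_mat P * A * P) = transpose_mat P * transpose_mat (transpose_mat P * A)"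
    using transpose_mult[OF mult_carrier_mat[OF PT A(1)] P] .
  also have "transpose_mat (transpose_mat P * A) = A * P"
    using transpose_mult[OF PT A(1)] A(2) by (simp add: spd_mat_def)
  also have "transpose_mat P * (A * P) = transpose_mat P * A * P"
    using assoc_mult_mat[OF PT A(1) P] by simp
  finally show "transpose_mat (transpose_mat P * A * P) = transpose_mat P * A * P" .
  fix v :: "real vec" assume "v \<in> carrier_vec (dim_row (transpose_mat P * A * P))"
    and nz: "v \<noteq> 0\<^sub>v (dim_row (transpose_mat P * A * P))"
  then have v: "v \<in> carrier_vec m" "v \<noteq> 0\<^sub>v m" using P by auto
  have "P *\<^sub>v v \<noteq> 0\<^sub>v n" using full_column_rank_imp_injective[OF P rank v(1)] v(2) by blast
  moreover have "P *\<^sub>v v \<in> carrier_vec n" using P v by auto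
  ultimately show "v \<bullet> ((transpose_mat P * A * P) *\<^sub>v v) > 0"
    unfolding galerkin_form[OF A(1) P v(1)] using A by (auto simp: spd_mat_def)
qed (use P in simp)

lemma energy_norm_galerkin:
  assumes A: "A \<in> carrier_mat n n" "spd_mat A" and P: "P \<in> carrier_mat n m"
    and rank: "vec_space.rank n P = m" and v: "v \<in> carrier_vec m"
  shows "energy_norm A (P *\<^sub>v v) = energy_norm (transpose_mat P * A * P) v"
proof (rule power2_eq_imp_eq)
  have "P *\<^sub>v v \<in> carrier_vec n" "transpose_mat P * A * P \<in> carrier_mat m m" using P A v by auto
  then show "(energy_norm A (P *\<^sub>v v))\<^sup>2 = (energy_norm (transpose_mat P * A * P) v)\<^sup>2"
    using energy_norm_square[OF A] energy_norm_square[OF _ spd_mat_galerkin[OF A P rank] v]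
      galerkin_form[OF A(1) P v] by simp
qed (simp_all add: energy_norm_nonneg)

section \<open>V-cycles with inexact coarsest-level solvers\<close>

lemma smooth_carrier:
  assumes "A \<in> carrier_mat n n" "G \<in> carrier_mat n n" "f \<in> carrier_vec n" "v \<in> carrier_vec n"
  shows "smooth A G f v \<in> carrier_vec n"
  using assms by (auto simp: smooth_def)

text \<open>The right-hand side f cancels, so the affine smoothing step acts linearly on
  differences.\<close>

lemma smooth_minus:
  assumes A: "A \<in> carrier_mat n n" and G: "G \<in> carrier_mat n n" and f: "f \<in> carrier_vec n"
    and v: "v \<in> carrier_vec n" and w: "w \<in> carrier_vec n"
  shows "smooth A G f v - smooth A G f w = (1\<^sub>m n - G * A) *\<^sub>v (v - w)"
proof -
  have Av: "A *\<^sub>v v \<in> carrier_vec n" "A *\<^sub>v w \<in> carrier_vec n" using A v w by auto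
  have G': "G *\<^sub>v f \<in> carrier_vec n" "G *\<^sub>v (A *\<^sub>v v) \<in> carrier_vec n" "G *\<^sub>v (A *\<^sub>v w) \<in> carrier_vec n"
    using G Av f by auto
  have "(1\<^sub>m n - G * A) *\<^sub>v (v - w) = (v - w) - (G *\<^sub>v (A *\<^sub>v v) - G *\<^sub>v (A *\<^sub>v w))"
    using A G v w Av
    by (simp add: minus_mult_distrib_mat_vec[of _ n n] mult_minus_distrib_mat_vec[OF A]
        mult_minus_distrib_mat_vec[OF G])
  then show ?thesis
    using G G' v w Av f by (simp add: smooth_def mult_minus_distrib_mat_vec[OF G]) (auto intro!: eq_vecI)
qed

text \<open>A convergent smoother contracts differences, and G = 0 turns the step into the identity.
  Both variants of post-smoothing are thus treated alike.\<close>

lemma energy_norm_smooth_minus_le: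
  assumes A: "A \<in> carrier_mat n n" "spd_mat A"
    and G: "convergent_smoother n A G \<or> G = 0\<^sub>m n n"
    and f: "f \<in> carrier_vec n" and v: "v \<in> carrier_vec n" and w: "w \<in> carrier_vec n"
  shows "energy_norm A (smooth A G f v - smooth A G f w) \<le> energy_norm A (v - w)"
  using G
proof
  assume conv: "convergent_smoother n A G"
  have GC: "G \<in> carrier_mat n n" and lt: "energy_mat_norm A (1\<^sub>m n - G * A) < 1"
    using conv by (auto simp: convergent_smoother_def)
  have "energy_norm A (smooth A G f v - smooth A G f w)
      \<le> energy_mat_norm A (1\<^sub>m n - G * A) * energy_norm A (v - w)"
    unfolding smooth_minus[OF A(1) GC f v w]
    using A GC v w by (intro energy_norm_mult_mat_vec_le) (auto intro!: minus_carrier_mat)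
  also have "\<dots> \<le> 1 * energy_norm A (v - w)"
    using lt by (intro mult_right_mono) (auto simp: energy_norm_nonneg)
  finally show ?thesis by simp
next
  assume "G = 0\<^sub>m n n"
  then have "smooth A G f u = u" if "u \<in> carrier_vec n" for u
    using that f A by (auto simp: smooth_def intro!: eq_vecI)
  then show ?thesis using v w by simp
qed

text \<open>Both cycles apply the same pre-smoothing to the same vector, so it cancels in their
  comparison, whereas post-smoothing acts on different vectors and must be controlled. Each of the
  three smoothing alternatives implies the levelwise disjunction \<open>N_smoother\<close>.\<close>

locale multigrid =
  fixes J :: nat and n :: "nat \<Rightarrow> nat" and A P M N :: "nat \<Rightarrow> real mat"
  assumes A_carrier: "\<And>j. j \<le> J \<Longrightarrow> A j \<in> carrier_mat (n j) (n j)"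
    and A_spd: "spd_mat (A J)"
    and P_carrier: "\<And>j. 1 \<le> j \<Longrightarrow> j \<le> J \<Longrightarrow> P j \<in> carrier_mat (n j) (n (j - 1))"
    and P_rank: "\<And>j. 1 \<le> j \<Longrightarrow> j \<le> J \<Longrightarrow> vec_space.rank (n j) (P j) = n (j - 1)"
    and galerkin: "\<And>j. 1 \<le> j \<Longrightarrow> j \<le> J \<Longrightarrow> A (j - 1) = transpose_mat (P j) * A j * P j"
    and M_carrier: "\<And>j. 1 \<le> j \<Longrightarrow> j \<le> J \<Longrightarrow> M j \<in> carrier_mat (n j) (n j)"
    and N_smoother: "\<And>j. 1 \<le> j \<Longrightarrow> j \<le> J \<Longrightarrow>
      convergent_smoother (n j) (A j) (N j) \<or> N j = 0\<^sub>m (n j) (n j)"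
begin

lemma N_carrier: "1 \<le> j \<Longrightarrow> j \<le> J \<Longrightarrow> N j \<in> carrier_mat (n j) (n j)"
  using N_smoother[of j] by (auto simp: convergent_smoother_def)

text \<open>Definiteness is given on the finest level and descends through the Galerkin condition,
  hence the induction on the distance from J.\<close>

lemma level_spd: "j \<le> J \<Longrightarrow> spd_mat (A j)"
proof (induction "J - j" arbitrary: j)
  case 0
  then show ?case using A_spd by simp
next
  case (Suc d)
  then have j: "Suc j \<le> J" "spd_mat (A (Suc j))" by auto
  show ?case
    using spd_mat_galerkin[OF A_carrier[OF j(1)] j(2), of "P (Suc j)" "n j"]
      P_carrier[of "Suc j"] P_rank[of "Suc j"] galerkin[of "Suc j"] j by simp
qed

lemma restricted_residual_carrier:
  assumes "Suc j \<le> J" "f \<in> carrier_vec (n (Suc j))" "v \<in> carrier_vec (n (Suc j))"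
  shows "restricted_residual (A (Suc j)) (P (Suc j)) (M (Suc j)) f v \<in> carrier_vec (n j)"
proof -
  have "smooth (A (Suc j)) (M (Suc j)) f v \<in> carrier_vec (n (Suc j))"
    using smooth_carrier A_carrier M_carrier assms by simp
  then have "f - A (Suc j) *\<^sub>v smooth (A (Suc j)) (M (Suc j)) f v \<in> carrier_vec (n (Suc j))"
    using A_carrier[OF assms(1)] assms by auto
  moreover have "transpose_mat (P (Suc j)) \<in> carrier_mat (n j) (n (Suc j))"
    using P_carrier[of "Suc j"] assms(1) by simp
  ultimately show ?thesis unfolding restricted_residual_def by (rule mult_mat_vec_carrier[rotated])
qed

lemma vcycle_carrier:
  assumes "\<And>g. g \<in> carrier_vec (n 0) \<Longrightarrow> S g \<in> carrier_vec (n 0)"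
  shows "j \<le> J \<Longrightarrow> f \<in> carrier_vec (n j) \<Longrightarrow> v \<in> carrier_vec (n j) \<Longrightarrow>
    vcycle n A P M N S j f v \<in> carrier_vec (n j)"
proof (induction j arbitrary: f v)
  case 0
  then show ?case using assms by simp
next
  case (Suc j)
  have P: "P (Suc j) \<in> carrier_mat (n (Suc j)) (n j)" using P_carrier[of "Suc j"] Suc.prems by simp
  show ?case
    using Suc A_carrier[of "Suc j"] M_carrier[of "Suc j"] N_carrier[of "Suc j"] P restricted_residual_carrier
    by (auto simp: Let_def intro!: smooth_carrier add_carrier_vec mult_mat_vec_carrier[OF P])
qed

text \<open>Everything on the way down is computed before the solver is called, so both cycles hand
  the same right-hand side to level 0. The solvers are arbitrary maps; they are compared at that
  single argument.\<close>

lemma energy_norm_vcycle_minus_le: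
  assumes S: "\<And>g. g \<in> carrier_vec (n 0) \<Longrightarrow> S g \<in> carrier_vec (n 0)"
    and S': "\<And>g. g \<in> carrier_vec (n 0) \<Longrightarrow> S' g \<in> carrier_vec (n 0)"
  shows "j \<le> J \<Longrightarrow> f \<in> carrier_vec (n j) \<Longrightarrow> v \<in> carrier_vec (n j) \<Longrightarrow>
    energy_norm (A j) (vcycle n A P M N S j f v - vcycle n A P M N S' j f v)
      \<le> energy_norm (A 0) (S (coarse_rhs n A P M j f v) - S' (coarse_rhs n A P M j f v))"
proof (induction j arbitrary: f v)
  case 0
  then show ?case by simp
next
  case (Suc j)
  define g where "g = restricted_residual (A (Suc j)) (P (Suc j)) (M (Suc j)) f v"
  define v1 where "v1 = smooth (A (Suc j)) (M (Suc j)) f v"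
  define u u' where "u = vcycle n A P M N S j g (0\<^sub>v (n j))" and "u' = vcycle n A P M N S' j g (0\<^sub>v (n j))"
  have AC: "A (Suc j) \<in> carrier_mat (n (Suc j)) (n (Suc j))" "spd_mat (A (Suc j))"
    using A_carrier level_spd Suc.prems by auto
  have P: "P (Suc j) \<in> carrier_mat (n (Suc j)) (n j)" using P_carrier[of "Suc j"] Suc.prems by simp
  have g: "g \<in> carrier_vec (n j)" unfolding g_def using restricted_residual_carrier Suc.prems by simp
  have u: "u \<in> carrier_vec (n j)" "u' \<in> carrier_vec (n j)"
    unfolding u_def u'_def using vcycle_carrier S S' g Suc.prems by auto
  have v1: "v1 \<in> carrier_vec (n (Suc j))"
    unfolding v1_def using smooth_carrier AC M_carrier Suc.prems by simp
  have Pu: "P (Suc j) *\<^sub>v u \<in> carrier_vec (n (Suc j))" "P (Suc j) *\<^sub>v u' \<in> carrier_vec (n (Suc j))"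
    using P u by auto
  \<comment> \<open>The pre-smoothed vector is common to both cycles; only the coarse corrections
    differ.\<close>
  have diff: "(v1 + P (Suc j) *\<^sub>v u) - (v1 + P (Suc j) *\<^sub>v u') = P (Suc j) *\<^sub>v (u - u')"
    unfolding mult_minus_distrib_mat_vec[OF P u] using v1 Pu by (intro eq_vecI) auto
  have "energy_norm (A (Suc j)) (vcycle n A P M N S (Suc j) f v - vcycle n A P M N S' (Suc j) f v)
      = energy_norm (A (Suc j)) (smooth (A (Suc j)) (N (Suc j)) f (v1 + P (Suc j) *\<^sub>v u)
          - smooth (A (Suc j)) (N (Suc j)) f (v1 + P (Suc j) *\<^sub>v u'))"
    by (simp add: Let_def g_def v1_def u_def u'_def)
  also have "\<dots> \<le> energy_norm (A (Suc j)) ((v1 + P (Suc j) *\<^sub>v u) - (v1 + P (Suc j) *\<^sub>v u'))"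
    using AC N_smoother[of "Suc j"] Suc.prems v1 Pu by (intro energy_norm_smooth_minus_le) auto
  also have "\<dots> = energy_norm (A j) (u - u')"
    unfolding diff using energy_norm_galerkin[OF AC P, of "u - u'"] P_rank[of "Suc j"] galerkin[of "Suc j"]
      Suc.prems u by simp
  also have "\<dots> \<le> energy_norm (A 0) (S (coarse_rhs n A P M j g (0\<^sub>v (n j))) - S' (coarse_rhs n A P M j g (0\<^sub>v (n j))))"
    unfolding u_def u'_def using Suc g by simp
  finally show ?case by (simp add: g_def)
qed

section \<open>Comparison of the exact and the inexact iteration\<close>

lemma exact_solver_carrier:
  "g \<in> carrier_vec (n 0) \<Longrightarrow> exact_solver A g \<in> carrier_vec (n 0)"
  using mat_inv_props(1)[OF A_carrier[of 0] level_spd[of 0]] by (auto simp: exact_solver_def)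

lemma exV_iterate_carrier:
  "b \<in> carrier_vec (n J) \<Longrightarrow> x0 \<in> carrier_vec (n J) \<Longrightarrow>
    exV_iterate n A P M N J b x0 k \<in> carrier_vec (n J)"
  by (induction k) (simp_all add: vcycle_carrier exact_solver_carrier)

lemma inV_iterate_carrier:
  assumes "\<And>k g. g \<in> carrier_vec (n 0) \<Longrightarrow> S k g \<in> carrier_vec (n 0)"
  shows "b \<in> carrier_vec (n J) \<Longrightarrow> x0 \<in> carrier_vec (n J) \<Longrightarrow>
    inV_iterate n A P M N S J b x0 k \<in> carrier_vec (n J)"
  by (induction k) (simp_all add: vcycle_carrier assms)

text \<open>Subtracting the error equations of two starting vectors with the same b eliminates the
  exact solution, so \<open>E\<close> also propagates differences of iterates.\<close>

lemma exact_vcycle_minus: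
  assumes E: "error_propagation_mat n A P M N J E"
    and b: "b \<in> carrier_vec (n J)" and y: "y \<in> carrier_vec (n J)" and z: "z \<in> carrier_vec (n J)"
  shows "vcycle n A P M N (exact_solver A) J b y - vcycle n A P M N (exact_solver A) J b z = E *\<^sub>v (y - z)"
proof -
  define x where "x = mat_inv (A J) *\<^sub>v b"
  have x: "x \<in> carrier_vec (n J)"
    using mat_inv_props(1)[OF A_carrier[of J] A_spd] b by (auto simp: x_def)
  have EC: "E \<in> carrier_mat (n J) (n J)"
    and E_err: "\<And>w. w \<in> carrier_vec (n J) \<Longrightarrow> x - vcycle n A P M N (exact_solver A) J b w = E *\<^sub>v (x - w)"
    using E b by (auto simp: error_propagation_mat_def x_def)
  define V where "V = vcycle n A P M N (exact_solver A) J b"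
  have V: "V w \<in> carrier_vec (n J)" if "w \<in> carrier_vec (n J)" for w
    using that b by (simp add: V_def vcycle_carrier exact_solver_carrier)
  have "V y - V z = (x - V z) - (x - V y)"
    using x V[OF y] V[OF z] by (intro eq_vecI) auto
  also have "\<dots> = E *\<^sub>v (x - z) - E *\<^sub>v (x - y)" using E_err[OF y] E_err[OF z] by (simp add: V_def)
  also have "\<dots> = E *\<^sub>v ((x - z) - (x - y))"
    using mult_minus_distrib_mat_vec[OF EC, of "x - z" "x - y"] x y z by simp
  also have "(x - z) - (x - y) = y - z" using x y z by (intro eq_vecI) auto
  finally show ?thesis by (simp add: V_def)
qed

text \<open>With q the energy norm of \<open>E\<close>, the number eps / (1 - q) is the fixed point
  of t \<mapsto> q t + eps. The bound therefore reproduces itself in the induction, and no geometric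
  sum has to be formed.\<close>

lemma energy_norm_iterates_minus_le:
  assumes E: "error_propagation_mat n A P M N J E" and E_norm: "energy_mat_norm (A J) E < 1"
    and S: "\<And>k g. g \<in> carrier_vec (n 0) \<Longrightarrow> S k g \<in> carrier_vec (n 0)"
    and b: "b \<in> carrier_vec (n J)" and x0: "x0 \<in> carrier_vec (n J)" and eps: "eps \<ge> 0"
    and coarse: "\<And>i. i < k \<Longrightarrow>
      energy_norm (A 0) (exact_solver A (coarse_rhs n A P M J b (inV_iterate n A P M N S J b x0 i))
        - S (Suc i) (coarse_rhs n A P M J b (inV_iterate n A P M N S J b x0 i))) \<le> eps"
  shows "energy_norm (A J) (exV_iterate n A P M N J b x0 k - inV_iterate n A P M N S J b x0 k)
    \<le> eps / (1 - energy_mat_norm (A J) E)"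
  using coarse
proof (induction k)
  case 0
  then show ?case using energy_norm_zero[OF A_carrier A_spd] x0 E_norm eps by simp
next
  case (Suc k)
  define e where "e = energy_mat_norm (A J) E"
  define y z where "y = exV_iterate n A P M N J b x0 k" and "z = inV_iterate n A P M N S J b x0 k"
  \<comment> \<open>\<open>Vz\<close>, the exact cycle started from the inexact iterate, is the
    intermediate point: \<open>Vy - Vz\<close> involves only the linear \<open>E\<close>, while
    \<open>Vz - Wz\<close> differs only in the solver.\<close>
  define Vy Vz Wz where "Vy = vcycle n A P M N (exact_solver A) J b y"
    and "Vz = vcycle n A P M N (exact_solver A) J b z" and "Wz = vcycle n A P M N (S (Suc k)) J b z"
  have AC: "A J \<in> carrier_mat (n J) (n J)" "spd_mat (A J)" using A_carrier A_spd by auto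
  have EC: "E \<in> carrier_mat (n J) (n J)" using E by (simp add: error_propagation_mat_def)
  have e: "0 \<le> e" "e < 1" using energy_mat_norm_nonneg[OF AC EC] E_norm by (auto simp: e_def)
  have y: "y \<in> carrier_vec (n J)" and z: "z \<in> carrier_vec (n J)"
    unfolding y_def z_def using exV_iterate_carrier inV_iterate_carrier S b x0 by auto
  have V: "Vy \<in> carrier_vec (n J)" "Vz \<in> carrier_vec (n J)" "Wz \<in> carrier_vec (n J)"
    unfolding Vy_def Vz_def Wz_def using vcycle_carrier exact_solver_carrier S b y z by auto
  have IH: "energy_norm (A J) (y - z) \<le> eps / (1 - e)"
    unfolding y_def z_def e_def using Suc by simp
  have "energy_norm (A J) (Vy - Wz) = energy_norm (A J) ((Vy - Vz) + (Vz - Wz))"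
    by (rule arg_cong[of _ _ "energy_norm (A J)"], rule eq_vecI) (use V in auto)
  also have "\<dots> \<le> energy_norm (A J) (Vy - Vz) + energy_norm (A J) (Vz - Wz)"
    using energy_norm_triangle[OF AC] V by simp
  also have "energy_norm (A J) (Vy - Vz) \<le> e * energy_norm (A J) (y - z)"
    unfolding Vy_def Vz_def exact_vcycle_minus[OF E b y z] e_def
    using energy_norm_mult_mat_vec_le[OF AC EC] y z by simp
  also have "e * energy_norm (A J) (y - z) \<le> e * (eps / (1 - e))"
    using IH e by (intro mult_left_mono) auto
  also have "energy_norm (A J) (Vz - Wz) \<le> eps"
    unfolding Vz_def Wz_def
    using energy_norm_vcycle_minus_le[where S = "exact_solver A" and S' = "S (Suc k)", OF exact_solver_carrier S order.refl b z] Suc.prems[of k]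
    by (simp add: z_def)
  also have "e * (eps / (1 - e)) + eps = eps / (1 - e)" using e by (simp add: field_simps)
  finally show ?case by (simp add: Vy_def Wz_def y_def z_def e_def)
qed

end

theorem mainTheorem4:
  fixes J nit :: nat
    and n :: "nat \<Rightarrow> nat"
    and A P M N :: "nat \<Rightarrow> real mat"
    and E :: "real mat"
    and b x0 x :: "real vec"
    and S :: "nat \<Rightarrow> real vec \<Rightarrow> real vec"
    and v0 v0in xex xin :: "nat \<Rightarrow> real vec"
    and eta :: "nat \<Rightarrow> real vec \<Rightarrow> real"
    and eps :: real
  assumes levels: "J \<ge> 1"
    and A_carrier: "\<And>j. j \<le> J \<Longrightarrow> A j \<in> carrier_mat (n j) (n j)"
    and A_spd: "spd_mat (A J)"
    and P_carrier: "\<And>j. 1 \<le> j \<Longrightarrow> j \<le> J \<Longrightarrow> P j \<in> carrier_mat (n j) (n (j - 1))"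
    and P_rank: "\<And>j. 1 \<le> j \<Longrightarrow> j \<le> J \<Longrightarrow> vec_space.rank (n j) (P j) = n (j - 1)"
    and galerkin: "\<And>j. 1 \<le> j \<Longrightarrow> j \<le> J \<Longrightarrow> A (j - 1) = transpose_mat (P j) * A j * P j"
    and smoothers:
      "(\<forall>j \<in> {1..J}. convergent_smoother (n j) (A j) (M j) \<and> convergent_smoother (n j) (A j) (N j)) \<or>
       (\<forall>j \<in> {1..J}. M j = 0\<^sub>m (n j) (n j) \<and> convergent_smoother (n j) (A j) (N j)) \<or>
       (\<forall>j \<in> {1..J}. convergent_smoother (n j) (A j) (M j) \<and> N j = 0\<^sub>m (n j) (n j))"
    and b_carrier: "b \<in> carrier_vec (n J)"
    and x0_carrier: "x0 \<in> carrier_vec (n J)"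
    and x_eq: "x = mat_inv (A J) *\<^sub>v b"
    and E_prop: "error_propagation_mat n A P M N J E"
    and E_norm: "energy_mat_norm (A J) E < 1"
    and nit: "nit \<ge> 1"
    and solver: "\<And>k f. f \<in> carrier_vec (n 0) \<Longrightarrow> S k f \<in> carrier_vec (n 0)"
    and xex_eq: "\<And>k. xex k = exV_iterate n A P M N J b x0 k"
    and xin_eq: "\<And>k. xin k = inV_iterate n A P M N S J b x0 k"
    and v0_eq: "\<And>k. v0 k = mat_inv (A 0) *\<^sub>v coarse_rhs n A P M J b (xin (k - 1))"
    and v0in_eq: "\<And>k. v0in k = S k (coarse_rhs n A P M J b (xin (k - 1)))"
    and eta_bound: "\<And>k. 1 \<le> k \<Longrightarrow> k \<le> nit \<Longrightarrow> energy_norm (A 0) (v0 k - v0in k) \<le> eta k (v0in k)"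
    and eps_pos: "eps > 0"
    and stopping: "\<And>k. 1 \<le> k \<Longrightarrow> k \<le> nit \<Longrightarrow> eta k (v0in k) \<le> eps"
  shows "energy_norm (A J) (xex nit - xin nit) \<le> eps / (1 - energy_mat_norm (A J) E)
    \<and> (\<forall>\<alpha> < 1. energy_mat_norm (A J) E < \<alpha> \<longrightarrow>
        energy_norm (A J) (xex nit - xin nit) \<le> eps / (1 - \<alpha>) \<and>
        (\<forall>\<theta> > 0. eps = (1 - \<alpha>) * \<theta> \<longrightarrow>
          energy_norm (A J) (x - xin nit) \<le> energy_norm (A J) (x - xex nit) + \<theta>))"
proof -
  interpret multigrid J n A P M N
  proof
    fix j assume "1 \<le> j" "j \<le> J"
    then have "j \<in> {1..J}" by simp
    then show "M j \<in> carrier_mat (n j) (n j)"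
      "convergent_smoother (n j) (A j) (N j) \<or> N j = 0\<^sub>m (n j) (n j)"
      using smoothers by (auto simp: convergent_smoother_def)
  qed (fact A_carrier A_spd P_carrier P_rank galerkin)+
  define e where "e = energy_mat_norm (A J) E"
  define d where "d = energy_norm (A J) (xex nit - xin nit)"
  \<comment> \<open>Iteration \<open>Suc i\<close> starts from \<open>xin i\<close>, so the bounds
    for iterations 1 to nit become bounds indexed by i < nit.\<close>
  have "energy_norm (A 0) (v0 (Suc i) - v0in (Suc i)) \<le> eps" if "i < nit" for i
    using eta_bound[of "Suc i"] stopping[of "Suc i"] that by simp
  then have main: "d \<le> eps / (1 - e)"
    unfolding d_def e_def xex_eq xin_eq
    using energy_norm_iterates_minus_le[OF E_prop E_norm solver b_carrier x0_carrier, where eps = eps and k = nit] eps_pos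
    by (simp add: v0_eq v0in_eq xin_eq exact_solver_def)
  have alpha: "d \<le> eps / (1 - \<alpha>)" if "\<alpha> < 1" "e < \<alpha>" for \<alpha>
  proof -
    \<comment> \<open>From e < \<alpha> < 1, both denominators are positive and 1 - \<alpha> is the
      smaller one.\<close>
    have "eps / (1 - e) \<le> eps / (1 - \<alpha>)"
      using that eps_pos by (intro divide_left_mono) auto
    with main show ?thesis by simp
  qed
  have x: "x \<in> carrier_vec (n J)"
    using mat_inv_props(1)[OF A_carrier[of J] A_spd] b_carrier by (auto simp: x_eq)
  have xs: "xex nit \<in> carrier_vec (n J)" "xin nit \<in> carrier_vec (n J)"
    unfolding xex_eq xin_eq using exV_iterate_carrier inV_iterate_carrier solver b_carrier x0_carrier by auto
  have "x - xin nit = (x - xex nit) + (xex nit - xin nit)"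
    using x xs by (intro eq_vecI) auto
  then have tri: "energy_norm (A J) (x - xin nit) \<le> energy_norm (A J) (x - xex nit) + d"
    using energy_norm_triangle[OF A_carrier[of J] A_spd, of "x - xex nit" "xex nit - xin nit"] x xs
    by (simp add: d_def)
  show ?thesis
  proof (intro conjI allI impI)
    show "energy_norm (A J) (xex nit - xin nit) \<le> eps / (1 - energy_mat_norm (A J) E)"
      using main by (simp add: d_def e_def)
    fix \<alpha> :: real assume \<alpha>: "\<alpha> < 1" "energy_mat_norm (A J) E < \<alpha>"
    then show "energy_norm (A J) (xex nit - xin nit) \<le> eps / (1 - \<alpha>)"
      using alpha by (simp add: d_def e_def)
    fix \<theta> :: real assume "\<theta> > 0" "eps = (1 - \<alpha>) * \<theta>"
    then have "d \<le> \<theta>" using alpha[of \<alpha>] \<alpha> by (simp add: e_def)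
    then show "energy_norm (A J) (x - xin nit) \<le> energy_norm (A J) (x - xex nit) + \<theta>"
      using tri by linarith
  qed
qed

end
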